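(* No uncountable ordinal space is $CT_2$.
   Context: An ordinal $\alpha$ is identified with the set of all ordinals less than $\alpha$ and carries the order topology. For a $T_1$-space $X$, $\mathrm{Cld}(X)$ denotes the set of all non-empty closed subsets of $X$, endowed with the Vietoris topology, i.e. the topology having as a subbase all sets $U^-=\{F\in\mathrm{Cld}(X): F\cap U\neq\emptyset\}$ and $U^+=\{F\in\mathrm{Cld}(X): F\subseteq U\}$ with $U$ open in $X$. $X$ is called $CT_2$ if there is a continuous map $\phi=(\phi_1,\phi_2):X^2\setminus\{(x,x):x\in X\}\to\mathrm{Cld}(X)^2$ (domain with the subspace topology from $X^2$) such that for all $x_1\neq x_2$ in $X$: $\phi_1(x_1,x_2)\cup\phi_2(x_1,x_2)=X$, $x_1\notin\phi_1(x_1,x_2)$ and $x_2\notin\phi_2(x_1,x_2)$. *)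

theory Defs
  imports "HOL-Analysis.Analysis"
begin

definition Cld :: "'a topology \<Rightarrow> 'a set set" where
  "Cld X = {F. closedin X F \<and> F \<noteq> {}}"

definition vietoris_topology :: "'a topology \<Rightarrow> 'a set topology" where
  "vietoris_topology X = topology_generated_by
     ({{F \<in> Cld X. F \<inter> U \<noteq> {}} | U. openin X U} \<union>
      {{F \<in> Cld X. F \<subseteq> U} | U. openin X U})"

lemma topspace_vietoris_topology [simp]: "topspace (vietoris_topology X) = Cld X"
proof -
  have "Cld X = {F \<in> Cld X. F \<subseteq> topspace X}"
    by (auto simp: Cld_def dest: closedin_subset)
  then show ?thesis
    unfolding vietoris_topology_def topology_generated_by_topspace by blast
qed

(* The T1 requirement on X is not listed because the last three clauses force it:
   x2 lies in fst (phi (x1, x2)), so the complement of this closed set is an open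
   neighbourhood of x1 that misses x2. *)
definition CT2_space :: "'a topology \<Rightarrow> bool" where
  "CT2_space X \<longleftrightarrow>
     (\<exists>\<phi> :: 'a \<times> 'a \<Rightarrow> 'a set \<times> 'a set.
        continuous_map
          (subtopology (prod_topology X X)
             (topspace X \<times> topspace X - {(x, x) | x. x \<in> topspace X}))
          (prod_topology (vietoris_topology X) (vietoris_topology X)) \<phi> \<and>
        (\<forall>x1 \<in> topspace X. \<forall>x2 \<in> topspace X. x1 \<noteq> x2 \<longrightarrow>
           fst (\<phi> (x1, x2)) \<union> snd (\<phi> (x1, x2)) = topspace X \<and>
           x1 \<notin> fst (\<phi> (x1, x2)) \<and>
           x2 \<notin> snd (\<phi> (x1, x2))))"

(* Ordinal spaces are rendered, up to order isomorphism, as types of class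
   {wellorder, linorder_topology}: the second class says that the open sets are those
   generated by the open rays, i.e. euclidean is the order topology. *)

end

theory Submission
  imports Defs
begin

text \<open>
  The argument takes place in the initial segment \<open>W\<close> of the points with only countably many
  predecessors, a copy of \<open>\<omega>\<^sub>1\<close>. Every countable subset of \<open>W\<close> is strictly bounded in \<open>W\<close>,
  hence every binary operation on \<open>W\<close> has arbitrarily large limit points \<open>\<delta> \<in> W\<close> such that the
  predecessors of \<open>\<delta>\<close> are closed under it (\<open>countable_segments_closing_point\<close>). Let \<open>\<phi>\<close> witness
  that the space is \<open>CT\<^sub>2\<close>, write \<open>\<phi>\<^sub>1\<close> and \<open>\<phi>\<^sub>2\<close> for its components, and recall that for fixed
  \<open>p\<close> the pairs \<open>(a, b)\<close> with \<open>p \<notin> \<phi>\<^sub>i (a, b)\<close> form an open set (\<open>open_avoiding\<close>).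

  Fix \<open>x \<in> W\<close>. For all sufficiently large \<open>p \<in> W\<close>, the point \<open>p\<close> belongs to \<open>\<phi>\<^sub>1 (x, y)\<close> for
  all sufficiently large \<open>y \<in> W\<close> (\<open>eventually_in_fst\<close>). Otherwise there are unboundedly many
  \<open>p\<close> for which \<open>p \<notin> \<phi>\<^sub>1 (x, y)\<close>, and so \<open>p \<in> \<phi>\<^sub>2 (x, y)\<close>, for unboundedly many \<open>y\<close>. The set of
  those \<open>y \<noteq> x\<close> with \<open>p \<in> \<phi>\<^sub>2 (x, y)\<close> is closed away from \<open>x\<close>, so some limit \<open>\<delta>\<close> of such \<open>p\<close> lies in all of the
  corresponding sets; then these \<open>p\<close> belong to the closed set \<open>\<phi>\<^sub>2 (x, \<delta>)\<close>, and so does \<open>\<delta>\<close>,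
  which is absurd.

  Now let \<open>B x\<close> be a bound beyond which \<open>p\<close> is sufficiently large for \<open>x\<close>, and let \<open>\<delta> \<in> W\<close> be a
  limit point with \<open>B u < \<delta>\<close> for all \<open>u < \<delta>\<close>. As \<open>\<delta>\<close> has countably many predecessors, a single
  \<open>y > \<delta>\<close> satisfies \<open>\<delta> \<in> \<phi>\<^sub>1 (u, y)\<close> for all \<open>u < \<delta>\<close>. Letting \<open>u\<close> tend to \<open>\<delta>\<close> gives
  \<open>\<delta> \<in> \<phi>\<^sub>1 (\<delta>, y)\<close>, which is absurd.
\<close>

text \<open>
  The points with countably many predecessors. In an uncountable well-order they form an initial
  segment of type \<open>\<omega>\<^sub>1\<close>, which is the whole space exactly when the space itself has type \<open>\<omega>\<^sub>1\<close>.
\<close>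

definition countable_segments :: "'a::wellorder set" where
  "countable_segments = {x. countable {..x}}"

lemma countable_segments_downward:
  assumes "x \<in> countable_segments" and "y \<le> x"
  shows "y \<in> countable_segments"
proof -
  have "{..y} \<subseteq> {..x}"
    using assms(2) by auto
  with assms(1) show ?thesis
    unfolding countable_segments_def using countable_subset by blast
qed

lemma uncountable_countable_segments:
  assumes "uncountable (UNIV :: 'a::wellorder set)"
  shows "uncountable (countable_segments :: 'a set)"
proof
  assume count: "countable (countable_segments :: 'a set)"
  then have "countable_segments \<noteq> (UNIV :: 'a set)"
    using assms by auto
  then obtain z0 :: 'a where z0: "z0 \<notin> countable_segments"
    by blast
  define z :: 'a where "z = (LEAST z. z \<notin> countable_segments)"
  have z: "z \<notin> countable_segments"
    unfolding z_def using z0 by (rule LeastI)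
  have "{..<z} \<subseteq> countable_segments"
    unfolding z_def using not_less_Least by blast
  then have "countable {..<z}"
    using count countable_subset by blast
  moreover have "{..z} = insert z {..<z}"
    by auto
  ultimately have "z \<in> countable_segments"
    by (simp add: countable_segments_def)
  with z show False ..
qed

lemma countable_segments_bound:
  assumes "uncountable (UNIV :: 'a::wellorder set)"
    and "countable A" and "A \<subseteq> (countable_segments :: 'a set)"
  shows "\<exists>z\<in>countable_segments. \<forall>a\<in>A. a < z"
proof -
  have "countable (\<Union>a\<in>A. {..a})"
    using assms(2,3) by (auto simp: countable_segments_def)
  then have "\<not> countable_segments \<subseteq> (\<Union>a\<in>A. {..a})"
    using uncountable_countable_segments[OF assms(1)] countable_subset by blast
  then obtain z where "z \<in> countable_segments" "z \<notin> (\<Union>a\<in>A. {..a})"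
    by blast
  then show ?thesis
    by (intro bexI[of _ z]) (auto simp: not_le)
qed

text \<open>
  The closing-off argument: \<open>\<delta>\<close> is the supremum of a sequence in which each term exceeds all values
  of the operation at arguments up to the preceding term.
\<close>

lemma countable_segments_closing_point:
  fixes h :: "'a::wellorder \<Rightarrow> 'a \<Rightarrow> 'a"
  assumes unc: "uncountable (UNIV :: 'a set)"
    and h: "\<And>u w. u \<in> countable_segments \<Longrightarrow> w \<in> countable_segments \<Longrightarrow> h u w \<in> countable_segments"
    and \<beta>: "\<beta> \<in> countable_segments"
  shows "\<exists>\<delta>\<in>countable_segments. \<beta> < \<delta> \<and> (\<forall>u<\<delta>. \<forall>w<\<delta>. h u w < \<delta>) \<and> (\<forall>u<\<delta>. \<exists>v<\<delta>. u < v)"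
proof -
  have "\<exists>g\<in>countable_segments. z < g \<and> (\<forall>u\<le>z. \<forall>w\<le>z. h u w < g)"
    if z: "z \<in> countable_segments" for z
  proof -
    let ?A = "insert z ((\<lambda>(u, w). h u w) ` ({..z} \<times> {..z}))"
    have "countable ?A"
      using z by (simp add: countable_segments_def)
    moreover have "?A \<subseteq> countable_segments"
      using z h countable_segments_downward[OF z] by auto
    ultimately obtain g where "g \<in> countable_segments" "\<forall>a\<in>?A. a < g"
      using countable_segments_bound[OF unc] by blast
    then show ?thesis
      by (intro bexI[of _ g]) auto
  qed
  then obtain g where g: "\<And>z. z \<in> countable_segments \<Longrightarrow> g z \<in> countable_segments"
    "\<And>z. z \<in> countable_segments \<Longrightarrow> z < g z"
    "\<And>z u w. z \<in> countable_segments \<Longrightarrow> u \<le> z \<Longrightarrow> w \<le> z \<Longrightarrow> h u w < g z"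
    by metis
  define s where "s n = (g ^^ n) \<beta>" for n
  have s_Suc: "s (Suc n) = g (s n)" for n
    by (simp add: s_def)
  have s: "s n \<in> countable_segments" for n
    by (induction n) (auto simp: s_Suc g(1) s_def \<beta>)
  have less_Suc: "s n < s (Suc n)" for n
    unfolding s_Suc using g(2) s by blast
  have mono: "s m \<le> s n" if "m \<le> n" for m n
    by (rule lift_Suc_mono_le[of s, OF less_imp_le[OF less_Suc] that])
  define \<delta> where "\<delta> = (LEAST z. \<forall>n. s n < z)"
  obtain z where z: "z \<in> countable_segments" "\<forall>n. s n < z"
    using countable_segments_bound[OF unc, of "range s"] s by auto
  have s_less: "\<forall>n. s n < \<delta>"
    unfolding \<delta>_def using z(2) by (rule LeastI)
  have cofinal: "\<exists>n. u \<le> s n" if "u < \<delta>" for u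
    using not_less_Least[of u "\<lambda>z. \<forall>n. s n < z"] that
    unfolding \<delta>_def by (auto simp: not_less)
  show ?thesis
  proof (intro bexI[of _ \<delta>] conjI allI impI)
    have "\<delta> \<le> z"
      unfolding \<delta>_def using z(2) by (rule Least_le)
    then show "\<delta> \<in> countable_segments"
      using countable_segments_downward z(1) by blast
    show "\<beta> < \<delta>"
      using s_less[rule_format, of 0] by (simp add: s_def)
  next
    fix u w assume "u < \<delta>" "w < \<delta>"
    then obtain m n where "u \<le> s m" "w \<le> s n"
      using cofinal by blast
    then have "u \<le> s (max m n)" "w \<le> s (max m n)"
      using mono[of m "max m n"] mono[of n "max m n"] by auto
    then have "h u w < s (Suc (max m n))"
      unfolding s_Suc using g(3) s by blast
    then show "h u w < \<delta>"
      using s_less less_trans by blast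
  next
    fix u assume "u < \<delta>"
    then obtain n where "u \<le> s n"
      using cofinal by blast
    then show "\<exists>v<\<delta>. u < v"
      using less_Suc[of n] s_less by (meson le_less_trans)
  qed
qed

text \<open>
  The only consequence of continuity that is needed. The non-empty closed sets avoiding \<open>p\<close>, being
  those contained in the open set \<open>- {p}\<close>, form a Vietoris-open set, and the complement of the diagonal is open,
  so that no subspace topology remains.
\<close>

lemma open_avoiding:
  fixes \<psi> :: "'a::t2_space \<times> 'a \<Rightarrow> 'a set"
  assumes "continuous_map
      (subtopology (prod_topology euclidean euclidean)
        (topspace euclidean \<times> topspace euclidean - {(x, x) | x. x \<in> topspace euclidean}))
      (vietoris_topology euclidean) \<psi>"
  shows "open {z. fst z \<noteq> snd z \<and> p \<notin> \<psi> z}"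
proof -
  let ?D = "UNIV \<times> UNIV - {(x, x) | x. x \<in> (UNIV :: 'a set)}"
  let ?V = "{F \<in> Cld (euclidean :: 'a topology). F \<subseteq> - {p}}"
  have "openin (vietoris_topology euclidean) ?V"
    unfolding vietoris_topology_def
    by (rule topology_generated_by_Basis) (auto intro!: exI[of _ "- {p}"])
  then have "openin (subtopology (prod_topology euclidean euclidean) ?D) {z \<in> ?D. \<psi> z \<in> ?V}"
    using openin_continuous_map_preimage[OF assms, of ?V] by simp
  moreover have "{z \<in> ?D. \<psi> z \<in> ?V} = {z. fst z \<noteq> snd z \<and> p \<notin> \<psi> z}"
    using continuous_map_image_subset_topspace[OF assms] by (auto simp: image_subset_iff)
  moreover have "open ?D"
  proof -
    have "?D = {z. fst z \<noteq> snd z}"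
      by auto
    then show ?thesis
      by (simp add: open_Collect_neq continuous_on_fst continuous_on_snd)
  qed
  ultimately show ?thesis
    by (simp add: openin_open_eq)
qed

text \<open>
  Stated for \<open>F y = \<phi>\<^sub>1 (x, y)\<close> and \<open>G y = \<phi>\<^sub>2 (x, y)\<close> with \<open>x\<close> fixed; the hypothesis \<open>open_G\<close> is what
  remains of the continuity of \<open>\<phi>\<close>.
\<close>

lemma eventually_in_fst:
  fixes x :: "'a::{wellorder, linorder_topology}" and F G :: "'a \<Rightarrow> 'a set"
  assumes unc: "uncountable (UNIV :: 'a set)" and x: "x \<in> countable_segments"
    and open_G: "\<And>p. open {y. x \<noteq> y \<and> p \<notin> G y}"
    and closed_G: "\<And>y. x \<noteq> y \<Longrightarrow> closed (G y)"
    and cover: "\<And>y. x \<noteq> y \<Longrightarrow> F y \<union> G y = UNIV"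
    and avoid: "\<And>y. x \<noteq> y \<Longrightarrow> y \<notin> G y"
  shows "\<exists>b\<in>countable_segments. \<forall>p\<in>countable_segments. b < p \<longrightarrow>
    (\<exists>c\<in>countable_segments. \<forall>y\<in>countable_segments. c < y \<longrightarrow> p \<in> F y)"
proof (rule ccontr)
  assume "\<not> ?thesis"
  then have "\<forall>b\<in>countable_segments. \<exists>p. p \<in> countable_segments \<and> b < p \<and>
      (\<forall>c\<in>countable_segments. \<exists>y. y \<in> countable_segments \<and> c < y \<and> p \<notin> F y)"
    by (simp add: Bex_def Ball_def)
  from bchoice[OF this] obtain P where
    P_all: "\<forall>b\<in>countable_segments. P b \<in> countable_segments \<and> b < P b \<and>
      (\<forall>c\<in>countable_segments. \<exists>y. y \<in> countable_segments \<and> c < y \<and> P b \<notin> F y)" ..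
  then have P: "P b \<in> countable_segments" "b < P b" if "b \<in> countable_segments" for b
    using that by simp_all
  define Y where "Y b c = (SOME y. y \<in> countable_segments \<and> c < y \<and> P b \<notin> F y)" for b c
  have "Y b c \<in> countable_segments \<and> c < Y b c \<and> P b \<notin> F (Y b c)"
    if "b \<in> countable_segments" "c \<in> countable_segments" for b c
    unfolding Y_def by (rule someI_ex) (use P_all that in simp)
  then have Y: "Y b c \<in> countable_segments" "c < Y b c" "P b \<notin> F (Y b c)"
    if "b \<in> countable_segments" "c \<in> countable_segments" for b c
    using that by simp_all
  have max_in: "max (P u) (Y u w) \<in> countable_segments"
    if "u \<in> countable_segments" "w \<in> countable_segments" for u w
    using P(1) Y(1) that by (simp add: max_def)
  have "\<exists>\<delta>\<in>countable_segments. x < \<delta> \<and> (\<forall>u<\<delta>. \<forall>w<\<delta>. max (P u) (Y u w) < \<delta>) \<and>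
      (\<forall>u<\<delta>. \<exists>v<\<delta>. u < v)"
    by (rule countable_segments_closing_point[where h = "\<lambda>u w. max (P u) (Y u w)",
          OF unc max_in x])
  then obtain \<delta> where \<delta>: "\<delta> \<in> countable_segments" "x < \<delta>"
    and closed_off: "\<And>u w. u < \<delta> \<Longrightarrow> w < \<delta> \<Longrightarrow> max (P u) (Y u w) < \<delta>"
    by blast
  have W: "u \<in> countable_segments" if "u < \<delta>" for u
    using countable_segments_downward[OF \<delta>(1)] that by simp
  (* Values y = Y u w at which P u lies in G y approach \<delta>. *)
  have P_in: "P u \<in> G \<delta>" if u: "u < \<delta>" for u
  proof (rule ccontr)
    assume "P u \<notin> G \<delta>"
    then have "\<delta> \<in> {y. x \<noteq> y \<and> P u \<notin> G y}"
      using \<delta>(2) by simp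
    then obtain b where b: "b < \<delta>" "{b<..\<delta>} \<subseteq> {y. x \<noteq> y \<and> P u \<notin> G y}"
      using open_left[OF open_G _ \<delta>(2)] by blast
    have "Y u b < \<delta>" "b < Y u b" "P u \<notin> F (Y u b)"
      using closed_off[OF u b(1)] Y u b(1) W by auto
    moreover from this have "Y u b \<in> {b<..\<delta>}"
      by simp
    then have "x \<noteq> Y u b" "P u \<notin> G (Y u b)"
      using b(2) by blast+
    ultimately show False
      using cover[of "Y u b"] by blast
  qed
  (* The points P u of the closed set G \<delta> approach \<delta>, which does not lie in G \<delta>. *)
  have "open (- G \<delta>)" "\<delta> \<in> - G \<delta>"
    using closed_G avoid \<delta>(2) by auto
  then obtain b where b: "b < \<delta>" "{b<..\<delta>} \<subseteq> - G \<delta>"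
    using open_left[OF _ _ \<delta>(2)] by blast
  have "b < P b" "P b < \<delta>"
    using closed_off[OF b(1) b(1)] P(2) W b(1) by auto
  then have "P b \<in> {b<..\<delta>}"
    by simp
  then have "P b \<notin> G \<delta>"
    using b(2) by blast
  with P_in[OF b(1)] show False
    by contradiction
qed

theorem mainTheorem12:
  assumes "uncountable (UNIV :: 'a :: {wellorder, linorder_topology} set)"
  shows "\<not> CT2_space (euclidean :: 'a topology)"
proof
  assume "CT2_space (euclidean :: 'a topology)"
  then obtain \<phi> :: "'a \<times> 'a \<Rightarrow> 'a set \<times> 'a set" where
    cont: "continuous_map
      (subtopology (prod_topology euclidean euclidean)
        (topspace euclidean \<times> topspace euclidean - {(x, x) | x. x \<in> topspace euclidean}))
      (prod_topology (vietoris_topology euclidean) (vietoris_topology euclidean)) \<phi>"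
    and cover: "\<And>a b. a \<noteq> b \<Longrightarrow> fst (\<phi> (a, b)) \<union> snd (\<phi> (a, b)) = UNIV"
    and avoid1: "\<And>a b. a \<noteq> b \<Longrightarrow> a \<notin> fst (\<phi> (a, b))"
    and avoid2: "\<And>a b. a \<noteq> b \<Longrightarrow> b \<notin> snd (\<phi> (a, b))"
    unfolding CT2_space_def by auto
  note cont_fst = continuous_map_compose[OF cont continuous_map_fst, unfolded o_def]
  note cont_snd = continuous_map_compose[OF cont continuous_map_snd, unfolded o_def]
  have closed_snd: "closed (snd (\<phi> (a, b)))" if "a \<noteq> b" for a b
    using continuous_map_image_subset_topspace[OF cont_snd] that
    by (auto simp: image_subset_iff Cld_def)
  have open_fst: "open {a. a \<noteq> y \<and> p \<notin> fst (\<phi> (a, y))}" for y p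
    using continuous_open_vimage[OF open_avoiding[OF cont_fst, of p], of "\<lambda>a. (a, y)"]
    by (simp add: vimage_def continuous_on_Pair)
  have open_snd: "open {b. x \<noteq> b \<and> p \<notin> snd (\<phi> (x, b))}" for x p
    using continuous_open_vimage[OF open_avoiding[OF cont_snd, of p], of "\<lambda>b. (x, b)"]
    by (simp add: vimage_def continuous_on_Pair)
  have "\<forall>x\<in>countable_segments. \<exists>b\<in>countable_segments. \<forall>p\<in>countable_segments. b < p \<longrightarrow>
    (\<exists>c\<in>countable_segments. \<forall>y\<in>countable_segments. c < y \<longrightarrow> p \<in> fst (\<phi> (x, y)))"
    using eventually_in_fst[OF assms _ open_snd closed_snd cover avoid2] by blast
  then obtain B where B: "\<And>x. x \<in> countable_segments \<Longrightarrow> B x \<in> countable_segments"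
    "\<And>x p. x \<in> countable_segments \<Longrightarrow> p \<in> countable_segments \<Longrightarrow> B x < p \<Longrightarrow>
      \<exists>c\<in>countable_segments. \<forall>y\<in>countable_segments. c < y \<longrightarrow> p \<in> fst (\<phi> (x, y))"
    by metis
  obtain \<beta> :: 'a where \<beta>: "\<beta> \<in> countable_segments"
    using uncountable_countable_segments[OF assms] by (metis countable_empty ex_in_conv)
  have "\<exists>\<delta>\<in>countable_segments. \<beta> < \<delta> \<and> (\<forall>u<\<delta>. \<forall>w<\<delta>. B u < \<delta>) \<and> (\<forall>u<\<delta>. \<exists>v<\<delta>. u < v)"
    by (rule countable_segments_closing_point[where h = "\<lambda>u w. B u", OF assms B(1) \<beta>])
  then obtain \<delta> where \<delta>: "\<delta> \<in> countable_segments" "\<beta> < \<delta>" "\<And>u. u < \<delta> \<Longrightarrow> B u < \<delta>"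
    and limit: "\<And>u. u < \<delta> \<Longrightarrow> \<exists>v<\<delta>. u < v"
    by blast
  have "\<exists>c\<in>countable_segments. \<forall>y\<in>countable_segments. c < y \<longrightarrow> \<delta> \<in> fst (\<phi> (u, y))"
    if "u < \<delta>" for u
    using B(2) \<delta> that countable_segments_downward[OF \<delta>(1)] by simp
  then obtain C where C: "\<And>u. u < \<delta> \<Longrightarrow> C u \<in> countable_segments"
    "\<And>u y. u < \<delta> \<Longrightarrow> y \<in> countable_segments \<Longrightarrow> C u < y \<Longrightarrow> \<delta> \<in> fst (\<phi> (u, y))"
    by metis
  have "{..<\<delta>} \<subseteq> {..\<delta>}"
    by auto
  then have "countable {..<\<delta>}"
    using \<delta>(1) countable_subset unfolding countable_segments_def by blast
  then have "countable (insert \<delta> (C ` {..<\<delta>}))"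
    by simp
  moreover have "insert \<delta> (C ` {..<\<delta>}) \<subseteq> countable_segments"
    using \<delta>(1) C(1) by auto
  (* One y serves all predecessors u of \<delta>, because they are countably many. *)
  ultimately obtain y where y: "y \<in> countable_segments"
    "\<forall>a \<in> insert \<delta> (C ` {..<\<delta>}). a < y"
    using countable_segments_bound[OF assms] by blast
  have in_fst: "\<delta> \<in> fst (\<phi> (u, y))" if "u < \<delta>" for u
    using C(2)[OF that y(1)] y(2) that by simp
  have "\<delta> \<in> {a. a \<noteq> y \<and> \<delta> \<notin> fst (\<phi> (a, y))}"
    using avoid1 y(2) by auto
  then obtain b where b: "b < \<delta>" "{b<..\<delta>} \<subseteq> {a. a \<noteq> y \<and> \<delta> \<notin> fst (\<phi> (a, y))}"
    using open_left[OF open_fst _ \<delta>(2)] by blast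
  from limit[OF b(1)] obtain v where "v < \<delta>" "b < v"
    by blast
  then have "v \<in> {b<..\<delta>}"
    by simp
  with b(2) in_fst[OF \<open>v < \<delta>\<close>] show False
    by blast
qed

end
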